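(* Let $(\mathcal{H},X^T)$ be a time-delayed dynamical network, and suppose $A$ is a stability matrix of $(\mathcal{H},X^T)$. If $\rho(A)<1$, then the undelayed dynamical network $(\mathcal{U}_{\mathcal{H}},X)$, $\mathcal{U}_{\mathcal{H}}(\mathbf{x})=\mathcal{H}(\mathbf{x},\dots,\mathbf{x})$, has a globally attracting fixed point.
   Context: Setting. $\mathcal{I}=\{1,\dots,n\}$; for $i\in\mathcal{I}$, $(X_i,d)$ is a complete metric space and $\varphi_i:X_i\to X_i$ satisfies $L_i=\sup_{x\neq y}d(\varphi_i(x),\varphi_i(y))/d(x,y)<\infty$. $X=\prod_{i}X_i$ with metric $d_{max}(\mathbf{x},\mathbf{y})=\max_i d(x_i,y_i)$, and $\varphi=(\varphi_1,\dots,\varphi_n)$ acts coordinatewise. Time-delayed networks. Fix an integer $T\ge 1$, $\mathcal{T}=\{0,-1,\dots,-T+1\}$, and let $X^T=\prod_{\tau\in\mathcal{T}}X^\tau$ with each $X^\tau=X$; $\varphi$ acts on $X^T$ by applying $\varphi$ to each factor. A time-delayed interaction is a map $H:X^T\to X$ such that for each $j\in\mathcal{I}$ there are a set $\mathcal{I}^j\subseteq\mathcal{I}\times\mathcal{T}$ and a continuous $H_j:\prod_{(i,\tau)\in\mathcal{I}^j}X_i^\tau\to X_j$ with $H(\mathbf{x})_j=H_j(\mathbf{x}|_{\mathcal{I}^j})$. The time-delayed dynamical network $(\mathcal{H},X^T)$ is given by $\mathcal{H}=H\circ\varphi:X^T\to X$, with orbits $\mathbf{x}^{k+1}=\mathcal{H}(\mathbf{x}^k,\mathbf{x}^{k-1},\dots,\mathbf{x}^{k-(T-1)})$.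 Associated network $(\mathcal{N}_{\mathcal{H}},X_{\mathcal{H}})$. Let $\mathcal{I}_{\mathcal{H}}=\{(i,j;\ell,m): 1\le j\le n,\ (i,-m)\in\mathcal{I}^j,\ 1\le \ell\le m\}$, let $X_{i,j;\ell,m}$ be a copy of $X_i$, and let $X_{\mathcal{H}}$ be the set of $\mathbf{x}\in X\times\prod_{\delta\in\mathcal{I}_{\mathcal{H}}}X_\delta$ with $x_{i,j;\ell,m}=x_{s,t;u,v}$ whenever $i=s$ and $\ell=u$ (metric: maximum of the coordinate distances). Put $x_{i,j;0,m}=x_i$. The map $\mathcal{N}_{\mathcal{H}}:X_{\mathcal{H}}\to X_{\mathcal{H}}$ has components: for $j\in\mathcal{I}$, $(\mathcal{N}_{\mathcal{H}})_j$ is $\mathcal{H}_j(\mathbf{x}^k,\dots,\mathbf{x}^{k-(T-1)})$ with each variable $x_i^{k-m}$, $m\ge1$, replaced by $x_{i,j;m,m}$ and each $x_i^k$ replaced by $x_i$; for $(i,j;\ell,m)\in\mathcal{I}_{\mathcal{H}}$, $(\mathcal{N}_{\mathcal{H}})_{i,j;\ell,m}(\mathbf{x})=x_{i,j;\ell-1,m}$. Stability matrix of $(\mathcal{H},X^T)$. With $\tilde{\mathcal{I}}=\mathcal{I}\cup\mathcal{I}_{\mathcal{H}}$, it is any matrix $\Lambda^T$ (transpose) where $\Lambda=(\Lambda_{\alpha\beta})_{\alpha,\beta\in\tilde{\mathcal{I}}}$ has finite entries $\Lambda_{\alpha\beta}\ge 0$, with $\Lambda_{\alpha\beta}=0$ if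 $x_\alpha$ is not one of the variables of the component $(\mathcal{N}_{\mathcal{H}})_\beta$, and $$d\big((\mathcal{N}_{\mathcal{H}})_\beta(\mathbf{x}),(\mathcal{N}_{\mathcal{H}})_\beta(\mathbf{y})\big)\le\sum_{\alpha\in\tilde{\mathcal{I}}}\Lambda_{\alpha\beta}\,d(x_\alpha,y_\alpha)\quad\text{for all }\beta\in\tilde{\mathcal{I}},\ \mathbf{x},\mathbf{y}\in X_{\mathcal{H}}.$$ $\rho$ is the spectral radius. A dynamical network $(\mathcal{F},X)$ has a globally attracting fixed point $\tilde{\mathbf{x}}\in X$ if $\tilde{\mathbf x}$ is a fixed point and $\lim_{k\to\infty}d_{max}(\mathcal{F}^k(\mathbf{x}),\tilde{\mathbf{x}})=0$ for every $\mathbf{x}\in X$. *)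

theory Defs
  imports "HOL-Analysis.Analysis" "Jordan_Normal_Form.Spectral_Radius"
begin

text \<open>
  The spaces $X_1,\dots,X_n$ are given as a family \<open>X :: nat \<Rightarrow> 'a metric\<close> of abstract metric
  spaces, each with its own carrier and distance; only the indices in \<open>{1..n}\<close> matter.
  Points of products are extensional functions.
\<close>

definition state_space :: "nat \<Rightarrow> (nat \<Rightarrow> 'a metric) \<Rightarrow> (nat \<Rightarrow> 'a) set"
  where "state_space n X = (\<Pi>\<^sub>E i\<in>{1..n}. mspace (X i))"

definition d_max :: "nat \<Rightarrow> (nat \<Rightarrow> 'a metric) \<Rightarrow> (nat \<Rightarrow> 'a) \<Rightarrow> (nat \<Rightarrow> 'a) \<Rightarrow> real"
  where "d_max n X x y = Max ((\<lambda>i. mdist (X i) (x i) (y i)) ` {1..n})"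

text \<open>The value lies in \<open>ennreal\<close>, so that it is \<open>0\<close> for a one-point space.\<close>

definition lipschitz_constant :: "'a metric \<Rightarrow> ('a \<Rightarrow> 'a) \<Rightarrow> ennreal"
  where "lipschitz_constant M f =
    (SUP (x, y) \<in> {(x, y). x \<in> mspace M \<and> y \<in> mspace M \<and> x \<noteq> y}.
       ennreal (mdist M (f x) (f y) / mdist M x y))"

definition globally_attracting_fixed_point ::
    "nat \<Rightarrow> (nat \<Rightarrow> 'a metric) \<Rightarrow> ((nat \<Rightarrow> 'a) \<Rightarrow> nat \<Rightarrow> 'a) \<Rightarrow> (nat \<Rightarrow> 'a) \<Rightarrow> bool"
  where "globally_attracting_fixed_point n X F p \<longleftrightarrow>
    p \<in> state_space n X \<and> F p = p \<and>
    (\<forall>x \<in> state_space n X. (\<lambda>k. d_max n X ((F ^^ k) x) p) \<longlonglongrightarrow> 0)"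


subsection \<open>Time-delayed networks\<close>

definition delay_times :: "nat \<Rightarrow> int set"
  where "delay_times T = {1 - int T..0}"

definition history_space :: "nat \<Rightarrow> (nat \<Rightarrow> 'a metric) \<Rightarrow> nat \<Rightarrow> (int \<Rightarrow> nat \<Rightarrow> 'a) set"
  where "history_space n X T = (\<Pi>\<^sub>E \<tau>\<in>delay_times T. state_space n X)"

text \<open>
  \<open>D j\<close> is the set $\mathcal I^j$ of pairs $(i,\tau)$ on which the $j$-th component of the
  interaction depends and \<open>h j\<close> is the continuous function $H_j$ of these variables.
\<close>

definition time_delayed_interaction ::
    "nat \<Rightarrow> (nat \<Rightarrow> 'a metric) \<Rightarrow> nat \<Rightarrow> (nat \<Rightarrow> (nat \<times> int) set) \<Rightarrow>
     (nat \<Rightarrow> (nat \<times> int \<Rightarrow> 'a) \<Rightarrow> 'a) \<Rightarrow> ((int \<Rightarrow> nat \<Rightarrow> 'a) \<Rightarrow> nat \<Rightarrow> 'a) \<Rightarrow> bool"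
  where "time_delayed_interaction n X T D h H \<longleftrightarrow>
    H \<in> history_space n X T \<rightarrow> state_space n X \<and>
    (\<forall>j \<in> {1..n}.
       D j \<subseteq> {1..n} \<times> delay_times T \<and>
       continuous_map (product_topology (\<lambda>(i, \<tau>). mtopology_of (X i)) (D j))
                      (mtopology_of (X j)) (h j) \<and>
       (\<forall>x \<in> history_space n X T. H x j = h j (\<lambda>(i, \<tau>) \<in> D j. x \<tau> i)))"

definition delayed_map ::
    "nat \<Rightarrow> nat \<Rightarrow> (nat \<Rightarrow> 'a \<Rightarrow> 'a) \<Rightarrow> ((int \<Rightarrow> nat \<Rightarrow> 'a) \<Rightarrow> nat \<Rightarrow> 'a) \<Rightarrow>
     (int \<Rightarrow> nat \<Rightarrow> 'a) \<Rightarrow> nat \<Rightarrow> 'a"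
  where "delayed_map n T \<phi> H x = H (\<lambda>\<tau>\<in>delay_times T. \<lambda>i\<in>{1..n}. \<phi> i (x \<tau> i))"

definition undelayed_map ::
    "nat \<Rightarrow> nat \<Rightarrow> (nat \<Rightarrow> 'a \<Rightarrow> 'a) \<Rightarrow> ((int \<Rightarrow> nat \<Rightarrow> 'a) \<Rightarrow> nat \<Rightarrow> 'a) \<Rightarrow>
     (nat \<Rightarrow> 'a) \<Rightarrow> nat \<Rightarrow> 'a"
  where "undelayed_map n T \<phi> H x = delayed_map n T \<phi> H (\<lambda>\<tau>\<in>delay_times T. x)"


subsection \<open>The associated network without delays\<close>

text \<open>\<open>Delay i j l m\<close> is the index $(i,j;\ell,m)$.\<close>

datatype node = Node nat | Delay nat nat nat nat

fun node_space :: "(nat \<Rightarrow> 'a metric) \<Rightarrow> node \<Rightarrow> 'a metric"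
  where
    "node_space X (Node i) = X i"
  | "node_space X (Delay i j l m) = X i"

definition delay_nodes :: "nat \<Rightarrow> (nat \<Rightarrow> (nat \<times> int) set) \<Rightarrow> node set"
  where "delay_nodes n D =
    {Delay i j l m | i j l m. j \<in> {1..n} \<and> (i, - int m) \<in> D j \<and> 1 \<le> l \<and> l \<le> m}"

definition nodes :: "nat \<Rightarrow> (nat \<Rightarrow> (nat \<times> int) set) \<Rightarrow> node set"
  where "nodes n D = Node ` {1..n} \<union> delay_nodes n D"

definition assoc_space ::
    "nat \<Rightarrow> (nat \<Rightarrow> 'a metric) \<Rightarrow> (nat \<Rightarrow> (nat \<times> int) set) \<Rightarrow> (node \<Rightarrow> 'a) set"
  where "assoc_space n X D =
    {x \<in> (\<Pi>\<^sub>E \<alpha>\<in>nodes n D. mspace (node_space X \<alpha>)).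
       \<forall>i j l m s t u v. Delay i j l m \<in> delay_nodes n D \<longrightarrow> Delay s t u v \<in> delay_nodes n D \<longrightarrow>
         i = s \<longrightarrow> l = u \<longrightarrow> x (Delay i j l m) = x (Delay s t u v)}"

text \<open>The convention $x_{i,j;0,m} = x_i$.\<close>

definition delay_node :: "nat \<Rightarrow> nat \<Rightarrow> nat \<Rightarrow> nat \<Rightarrow> node"
  where "delay_node i j l m = (if l = 0 then Node i else Delay i j l m)"

text \<open>
  In the component $j \in \mathcal I$, the variable $x_i^{k-m}$, which has the index $(i,-m)$ in
  $\mathcal I^j$, is replaced by $x_{i,j;m,m}$; for $m = 0$ this is $x_i$.
\<close>

fun assoc_component ::
    "(nat \<Rightarrow> 'a \<Rightarrow> 'a) \<Rightarrow> (nat \<Rightarrow> (nat \<times> int) set) \<Rightarrow> (nat \<Rightarrow> (nat \<times> int \<Rightarrow> 'a) \<Rightarrow> 'a) \<Rightarrow>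
     (node \<Rightarrow> 'a) \<Rightarrow> node \<Rightarrow> 'a"
  where
    "assoc_component \<phi> D h x (Node j) =
       h j (\<lambda>(i, \<tau>) \<in> D j. \<phi> i (x (delay_node i j (nat (- \<tau>)) (nat (- \<tau>)))))"
  | "assoc_component \<phi> D h x (Delay i j l m) = x (delay_node i j (l - 1) m)"

definition assoc_map ::
    "nat \<Rightarrow> (nat \<Rightarrow> 'a \<Rightarrow> 'a) \<Rightarrow> (nat \<Rightarrow> (nat \<times> int) set) \<Rightarrow> (nat \<Rightarrow> (nat \<times> int \<Rightarrow> 'a) \<Rightarrow> 'a) \<Rightarrow>
     (node \<Rightarrow> 'a) \<Rightarrow> node \<Rightarrow> 'a"
  where "assoc_map n \<phi> D h x = (\<lambda>\<beta>\<in>nodes n D. assoc_component \<phi> D h x \<beta>)"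

text \<open>The indices of the variables that occur in a component of the associated map.\<close>

fun component_vars :: "(nat \<Rightarrow> (nat \<times> int) set) \<Rightarrow> node \<Rightarrow> node set"
  where
    "component_vars D (Node j) =
       {delay_node i j m m | i m. (i, - int m) \<in> D j}"
  | "component_vars D (Delay i j l m) = {delay_node i j (l - 1) m}"


subsection \<open>Stability matrices\<close>

definition stability_coefficients ::
    "nat \<Rightarrow> (nat \<Rightarrow> 'a metric) \<Rightarrow> (nat \<Rightarrow> 'a \<Rightarrow> 'a) \<Rightarrow> (nat \<Rightarrow> (nat \<times> int) set) \<Rightarrow>
     (nat \<Rightarrow> (nat \<times> int \<Rightarrow> 'a) \<Rightarrow> 'a) \<Rightarrow> (node \<Rightarrow> node \<Rightarrow> real) \<Rightarrow> bool"
  where "stability_coefficients n X \<phi> D h \<Lambda> \<longleftrightarrow>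
    (\<forall>\<alpha> \<in> nodes n D. \<forall>\<beta> \<in> nodes n D.
       0 \<le> \<Lambda> \<alpha> \<beta> \<and> (\<alpha> \<notin> component_vars D \<beta> \<longrightarrow> \<Lambda> \<alpha> \<beta> = 0)) \<and>
    (\<forall>\<beta> \<in> nodes n D. \<forall>x \<in> assoc_space n X D. \<forall>y \<in> assoc_space n X D.
       mdist (node_space X \<beta>) (assoc_map n \<phi> D h x \<beta>) (assoc_map n \<phi> D h y \<beta>)
         \<le> (\<Sum>\<alpha>\<in>nodes n D. \<Lambda> \<alpha> \<beta> * mdist (node_space X \<alpha>) (x \<alpha>) (y \<alpha>)))"

text \<open>
  Matrices of the library have rows and columns numbered from \<open>0\<close>, hence the enumeration \<open>e\<close> of
  the index set; a different enumeration yields a similar matrix.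
\<close>

definition stability_matrix ::
    "nat \<Rightarrow> (nat \<Rightarrow> 'a metric) \<Rightarrow> (nat \<Rightarrow> 'a \<Rightarrow> 'a) \<Rightarrow> (nat \<Rightarrow> (nat \<times> int) set) \<Rightarrow>
     (nat \<Rightarrow> (nat \<times> int \<Rightarrow> 'a) \<Rightarrow> 'a) \<Rightarrow> real mat \<Rightarrow> bool"
  where "stability_matrix n X \<phi> D h A \<longleftrightarrow>
    (\<exists>\<Lambda> e. stability_coefficients n X \<phi> D h \<Lambda> \<and>
       bij_betw e {..<card (nodes n D)} (nodes n D) \<and>
       A = transpose_mat
             (mat (card (nodes n D)) (card (nodes n D)) (\<lambda>(a, b). \<Lambda> (e a) (e b))))"

end

theory Submission imports Defs begin

text \<open>
  A stability matrix \<open>A\<close> with \<open>\<rho>(A) < 1\<close> makes the undelayed map a contraction of the original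
  state space, for a maximum metric with suitably weighted coordinates; the Banach fixed point
  theorem then gives the attracting fixed point.

  The weights come from the matrix: since \<open>A\<close> is nonnegative and its powers tend to zero, there
  are \<open>w > 0\<close> and \<open>c < 1\<close> with \<open>A w \<le> c w\<close>, one weight for each node of the associated network
  (\<open>stability_matrix_weights\<close>).

  The undelayed map sits inside the associated network: if the node copies of \<open>X\<^sub>i\<close> all carry the
  same value \<open>x\<^sub>i\<close>, the component \<open>j\<close> of the associated map is the component \<open>j\<close> of the undelayed
  map at \<open>x\<close>. The stability inequality at \<open>j\<close> therefore bounds \<open>d(U(x)\<^sub>j, U(y)\<^sub>j)\<close> by
  \<open>\<Sum>\<^sub>\<alpha> \<Lambda>\<^sub>\<alpha>\<^sub>j d(x\<^sub>i, y\<^sub>i)\<close>, where \<open>\<alpha>\<close> is a copy of the site \<open>i\<close>. If \<open>d(x\<^sub>i, y\<^sub>i) \<le> q w\<^sub>i\<close> for all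
  \<open>i\<close>, then \<open>A w \<le> c w\<close> turns this into the bound \<open>c q w\<^sub>j\<close>, provided that the weight of every
  copy of \<open>i\<close> is at least \<open>w\<^sub>i\<close>. This last point is the heart of the matter
  (\<open>weight_le_delay_weight\<close>): a delay node merely copies the value of its predecessor, so its
  stability coefficient is at least one, and \<open>A w \<le> w\<close> forces the weights to increase along a
  chain of delay nodes. The exception is a one-point space \<open>X\<^sub>i\<close>, for which the coefficient may
  vanish, but then \<open>d(x\<^sub>i, y\<^sub>i) = 0\<close>.
\<close>

section \<open>Nonnegative matrices of spectral radius below one\<close>

text \<open>An eigenvector of \<open>k A\<close> for \<open>a\<close> is an eigenvector of \<open>A\<close> for \<open>a / k\<close>.\<close>

lemma spectral_radius_smult_less_one:
  fixes A :: "complex mat"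
  assumes A: "A \<in> carrier_mat m m" and m: "m > 0" and k: "k \<noteq> 0"
    and less: "norm k * spectral_radius A < 1"
  shows "spectral_radius (k \<cdot>\<^sub>m A) < 1"
proof -
  have kA: "k \<cdot>\<^sub>m A \<in> carrier_mat m m" using A by simp
  obtain a where a: "eigenvalue (k \<cdot>\<^sub>m A) a" and eq: "spectral_radius (k \<cdot>\<^sub>m A) = norm a"
    using spectral_radius_mem_max(1)[OF kA m] unfolding spectrum_def by auto
  from a obtain v where v: "v \<in> carrier_vec m" "v \<noteq> 0\<^sub>v m" and ev: "(k \<cdot>\<^sub>m A) *\<^sub>v v = a \<cdot>\<^sub>v v"
    using kA unfolding eigenvalue_def eigenvector_def by auto
  have "k \<cdot>\<^sub>v (A *\<^sub>v v) = a \<cdot>\<^sub>v v"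
    unfolding ev[symmetric] using v(1) A by (intro eq_vecI) auto
  then have "inverse k \<cdot>\<^sub>v (k \<cdot>\<^sub>v (A *\<^sub>v v)) = inverse k \<cdot>\<^sub>v (a \<cdot>\<^sub>v v)" by simp
  then have "A *\<^sub>v v = (a / k) \<cdot>\<^sub>v v"
    using k by (simp add: smult_smult_assoc divide_inverse mult.commute)
  then have "eigenvalue A (a / k)"
    using v A unfolding eigenvalue_def eigenvector_def by auto
  then have "norm (a / k) \<le> spectral_radius A"
    by (intro spectral_radius_mem_max(2)[OF A m]) (simp add: spectrum_def)
  then have "norm a \<le> norm k * spectral_radius A"
    using k by (simp add: norm_divide field_simps)
  then show ?thesis using eq less by simp
qed

lemma pow_mat_smult:
  fixes A :: "'a :: comm_ring_1 mat"
  assumes A: "A \<in> carrier_mat m m"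
  shows "(s \<cdot>\<^sub>m A) ^\<^sub>m k = s ^ k \<cdot>\<^sub>m (A ^\<^sub>m k)"
proof (induction k)
  case 0
  show ?case by (rule eq_matI) auto
next
  case (Suc k)
  have "A ^\<^sub>m k \<in> carrier_mat m m" using A by simp
  then show ?case using Suc A by (intro eq_matI) (auto simp: mult_ac)
qed

text \<open>
  After scaling by a factor above one the spectral radius is still below one, and the powers of
  the scaled matrix are bounded; hence the powers of the matrix itself decay geometrically.
\<close>

lemma pow_mat_eventually_small:
  fixes A :: "real mat"
  assumes A: "A \<in> carrier_mat m m" and m: "m > 0"
    and sr: "spectral_radius (map_mat complex_of_real A) < 1" and eps: "\<epsilon> > 0"
  shows "\<exists>N. \<forall>i<m. \<forall>j<m. \<bar>(A ^\<^sub>m N) $$ (i, j)\<bar> < \<epsilon>"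
proof -
  let ?B = "map_mat complex_of_real A"
  have B: "?B \<in> carrier_mat m m" using A by simp
  have sr0: "spectral_radius ?B \<ge> 0"
    using spectral_radius_mem_max(1)[OF B m] by auto
  \<comment> \<open>The choice of \<open>s\<close> makes \<open>1 / s\<close> the midpoint between the spectral radius and \<open>1\<close>.\<close>
  define s where "s = 2 / (1 + spectral_radius ?B)"
  have s: "s > 1" "s * spectral_radius ?B < 1"
    using sr sr0 unfolding s_def by (auto simp: field_simps)
  have "spectral_radius (complex_of_real s \<cdot>\<^sub>m ?B) < 1"
    using s by (intro spectral_radius_smult_less_one[OF B m]) auto
  from spectral_radius_jnf_norm_bound_less_1_upper_triangular[OF _ this, of m] B
  obtain C where C: "\<And>k. norm_bound ((complex_of_real s \<cdot>\<^sub>m ?B) ^\<^sub>m k) C" by auto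
  have bound: "s ^ k * \<bar>(A ^\<^sub>m k) $$ (i, j)\<bar> \<le> C" if "i < m" "j < m" for k i j
  proof -
    have dims: "dim_row (A ^\<^sub>m k) = m" "dim_col (A ^\<^sub>m k) = m"
      using pow_carrier_mat[OF A, of k] by auto
    have "(complex_of_real s \<cdot>\<^sub>m ?B) ^\<^sub>m k
        = complex_of_real s ^ k \<cdot>\<^sub>m map_mat complex_of_real (A ^\<^sub>m k)"
      by (simp add: pow_mat_smult[OF B] of_real_hom.mat_hom_pow[OF A])
    with C[of k] that dims
    have "norm (complex_of_real s ^ k * complex_of_real ((A ^\<^sub>m k) $$ (i, j))) \<le> C"
      unfolding norm_bound_def by auto
    then show ?thesis using s(1) by (simp add: norm_mult norm_power)
  qed
  obtain N where N: "C / \<epsilon> < s ^ N" using real_arch_pow[OF s(1)] by blast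
  have "\<bar>(A ^\<^sub>m N) $$ (i, j)\<bar> < \<epsilon>" if "i < m" "j < m" for i j
  proof -
    have "s ^ N * \<bar>(A ^\<^sub>m N) $$ (i, j)\<bar> < s ^ N * \<epsilon>"
      using bound[OF that, of N] N eps by (simp add: field_simps)
    then show ?thesis using s(1) by simp
  qed
  then show ?thesis by blast
qed

text \<open>
  With row sums of \<open>A\<^sup>N\<close> below one, the truncated Neumann series applied to the all-ones vector,
  \<open>w = (\<Sum>k<N. A\<^sup>k 1)\<close>, satisfies \<open>A w = w - 1 + A\<^sup>N 1 < w\<close>.
\<close>

lemma positive_weights_contracted_by_matrix:
  fixes A :: "real mat"
  assumes A: "A \<in> carrier_mat m m" and m: "m > 0"
    and nonneg: "\<And>i j. i < m \<Longrightarrow> j < m \<Longrightarrow> A $$ (i, j) \<ge> 0"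
    and sr: "spectral_radius (map_mat complex_of_real A) < 1"
  obtains w c where "0 \<le> c" "c < 1" "\<And>i. i < m \<Longrightarrow> w i > (0::real)"
    "\<And>i. i < m \<Longrightarrow> (\<Sum>j<m. A $$ (i, j) * w j) \<le> c * w i"
proof -
  \<comment> \<open>The vector \<open>u k\<close> is \<open>A\<^sup>k 1\<close>.\<close>
  define u where "u k i = (\<Sum>j<m. (A ^\<^sub>m k) $$ (i, j))" for k i
  have Ak: "A ^\<^sub>m k \<in> carrier_mat m m" for k using A by simp
  have u_0: "u 0 i = 1" if "i < m" for i
    using that A by (simp add: u_def one_mat_def if_distrib cong: if_cong)
  have u_Suc: "u (Suc k) i = (\<Sum>l<m. A $$ (i, l) * u k l)" if i: "i < m" for k i
  proof -
    have "A ^\<^sub>m Suc k = A * A ^\<^sub>m k"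
      by (induction k) (use A Ak in \<open>auto simp: assoc_mult_mat[of _ m m _ m _ m]\<close>)
    then have "u (Suc k) i = (\<Sum>j<m. \<Sum>l<m. A $$ (i, l) * (A ^\<^sub>m k) $$ (l, j))"
      unfolding u_def using i A Ak[of k]
      by (auto intro!: sum.cong simp: scalar_prod_def atLeast0LessThan)
    also have "\<dots> = (\<Sum>l<m. A $$ (i, l) * u k l)"
      unfolding u_def by (subst sum.swap) (simp add: sum_distrib_left)
    finally show ?thesis .
  qed
  have u_nonneg: "u k i \<ge> 0" if "i < m" for k i
    using that
  proof (induction k arbitrary: i)
    case 0
    then show ?case by (simp add: u_0)
  next
    case (Suc k)
    then show ?case by (auto simp: u_Suc intro!: sum_nonneg mult_nonneg_nonneg nonneg)
  qed
  obtain N where N: "\<And>i j. i < m \<Longrightarrow> j < m \<Longrightarrow> \<bar>(A ^\<^sub>m N) $$ (i, j)\<bar> < 1 / real m"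
    using pow_mat_eventually_small[OF A m sr, of "1 / real m"] m by auto
  have u_N: "u N i < 1" if i: "i < m" for i
  proof -
    have "u N i < (\<Sum>j<m. 1 / real m)"
      unfolding u_def
    proof (rule sum_strict_mono)
      show "(A ^\<^sub>m N) $$ (i, j) < 1 / real m" if "j \<in> {..<m}" for j
        using N[OF i, of j] that by auto
    qed (use m in auto)
    then show ?thesis using m by simp
  qed
  \<comment> \<open>The sum defining \<open>w\<close> must contain the term \<open>u 0 = 1\<close> to be positive.\<close>
  have "N \<noteq> 0" using u_N[OF m] u_0[OF m] by (cases N) auto
  define w where "w i = (\<Sum>k<N. u k i)" for i
  have w_pos: "w i > 0" if i: "i < m" for i
  proof -
    have "u 0 i \<le> w i"
      unfolding w_def using \<open>N \<noteq> 0\<close> i by (intro member_le_sum) (auto simp: u_nonneg)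
    then show ?thesis using u_0[OF i] by simp
  qed
  define W where "W i = (\<Sum>j<m. A $$ (i, j) * w j)" for i
  have W_less: "W i < w i" if i: "i < m" for i
  proof -
    have "W i = (\<Sum>k<N. u (Suc k) i)"
      unfolding W_def w_def u_Suc[OF i] by (subst sum.swap) (simp add: sum_distrib_left)
    also have "\<dots> = w i - u 0 i + u N i"
      unfolding w_def using sum_lessThan_telescope[of "\<lambda>k. u k i" N]
      by (simp add: sum_subtractf)
    finally show ?thesis using u_0[OF i] u_N[OF i] by simp
  qed
  have W_nonneg: "W i \<ge> 0" if "i < m" for i
    unfolding W_def using that
    by (auto intro!: sum_nonneg mult_nonneg_nonneg nonneg less_imp_le[OF w_pos])
  \<comment> \<open>Finitely many strict inequalities give a uniform factor \<open>c < 1\<close>.\<close>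
  define c where "c = Max ((\<lambda>i. W i / w i) ` {..<m})"
  have c_ge: "W i / w i \<le> c" if "i < m" for i
    unfolding c_def using that by (intro Max_ge) auto
  show ?thesis
  proof (rule that[of c w])
    show "0 \<le> c" using c_ge[OF m] W_nonneg[OF m] w_pos[OF m]
      by (meson divide_nonneg_pos order_trans)
    have "c \<in> (\<lambda>i. W i / w i) ` {..<m}"
      unfolding c_def using m by (intro Max_in) auto
    then show "c < 1" using W_less w_pos by auto
    show "(\<Sum>j<m. A $$ (i, j) * w j) \<le> c * w i" if "i < m" for i
      using c_ge[OF that] w_pos[OF that] by (simp add: W_def field_simps)
  qed (rule w_pos)
qed


section \<open>Contractions in weighted maximum metrics\<close>

definition weighted_dist ::
    "'i set \<Rightarrow> ('i \<Rightarrow> 'a metric) \<Rightarrow> ('i \<Rightarrow> real) \<Rightarrow> ('i \<Rightarrow> 'a) \<Rightarrow> ('i \<Rightarrow> 'a) \<Rightarrow> real"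
  where "weighted_dist I M w x y = Max ((\<lambda>i. mdist (M i) (x i) (y i) / w i) ` I)"

context
  fixes I :: "'i set" and M :: "'i \<Rightarrow> 'a metric" and w :: "'i \<Rightarrow> real"
  assumes finite_I: "finite I" and I_nonempty: "I \<noteq> {}"
    and w_pos: "\<And>i. i \<in> I \<Longrightarrow> w i > 0"
begin

lemma weighted_dist_le_iff:
  "weighted_dist I M w x y \<le> q \<longleftrightarrow> (\<forall>i\<in>I. mdist (M i) (x i) (y i) \<le> q * w i)"
  unfolding weighted_dist_def using finite_I I_nonempty w_pos
  by (auto simp: pos_divide_le_eq)

lemma weighted_dist_less_iff:
  "weighted_dist I M w x y < q \<longleftrightarrow> (\<forall>i\<in>I. mdist (M i) (x i) (y i) < q * w i)"
  unfolding weighted_dist_def using finite_I I_nonempty w_pos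
  by (auto simp: pos_divide_less_eq)

lemma mdist_le_weighted_dist:
  assumes "i \<in> I"
  shows "mdist (M i) (x i) (y i) \<le> weighted_dist I M w x y * w i"
  using weighted_dist_le_iff[of x y "weighted_dist I M w x y"] assms by auto

lemma weighted_dist_nonneg: "weighted_dist I M w x y \<ge> 0"
proof -
  obtain i where "i \<in> I" using I_nonempty by blast
  then have "0 \<le> weighted_dist I M w x y * w i"
    using mdist_le_weighted_dist[of i x y] mdist_nonneg[of "M i" "x i" "y i"] by linarith
  then show ?thesis using w_pos[OF \<open>i \<in> I\<close>] by (simp add: zero_le_mult_iff)
qed

lemma Metric_space_weighted_dist:
  "Metric_space (\<Pi>\<^sub>E i\<in>I. mspace (M i)) (weighted_dist I M w)"
proof
  fix x y :: "'i \<Rightarrow> 'a"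
  show "0 \<le> weighted_dist I M w x y" by (rule weighted_dist_nonneg)
  show "weighted_dist I M w x y = weighted_dist I M w y x"
    unfolding weighted_dist_def by (simp add: mdist_commute)
next
  fix x y
  assume x: "x \<in> (\<Pi>\<^sub>E i\<in>I. mspace (M i))" and y: "y \<in> (\<Pi>\<^sub>E i\<in>I. mspace (M i))"
  have "weighted_dist I M w x y = 0 \<longleftrightarrow> weighted_dist I M w x y \<le> 0"
    using weighted_dist_nonneg[of x y] by auto
  also have "\<dots> \<longleftrightarrow> (\<forall>i\<in>I. x i = y i)"
    unfolding weighted_dist_le_iff
  proof (intro ball_cong refl)
    fix i assume i: "i \<in> I"
    have "mdist (M i) (x i) (y i) = 0 \<longleftrightarrow> x i = y i"
      using x y i by (intro mdist_zero) auto
    then show "mdist (M i) (x i) (y i) \<le> 0 * w i \<longleftrightarrow> x i = y i"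
      using mdist_nonneg[of "M i" "x i" "y i"] by (metis mult_zero_left order_antisym order_refl)
  qed
  also have "\<dots> \<longleftrightarrow> x = y"
    using x y by (auto intro: PiE_ext)
  finally show "weighted_dist I M w x y = 0 \<longleftrightarrow> x = y" .
next
  fix x y z
  assume x: "x \<in> (\<Pi>\<^sub>E i\<in>I. mspace (M i))" and y: "y \<in> (\<Pi>\<^sub>E i\<in>I. mspace (M i))"
    and z: "z \<in> (\<Pi>\<^sub>E i\<in>I. mspace (M i))"
  show "weighted_dist I M w x z \<le> weighted_dist I M w x y + weighted_dist I M w y z"
    unfolding weighted_dist_le_iff
  proof
    fix i assume i: "i \<in> I"
    have "mdist (M i) (x i) (z i) \<le> mdist (M i) (x i) (y i) + mdist (M i) (y i) (z i)"
      using x y z i by (intro mdist_triangle) auto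
    then show "mdist (M i) (x i) (z i)
        \<le> (weighted_dist I M w x y + weighted_dist I M w y z) * w i"
      using mdist_le_weighted_dist[OF i, of x y] mdist_le_weighted_dist[OF i, of y z]
      by (simp add: distrib_right)
  qed
qed

text \<open>
  The index set is finite, so a Cauchy sequence converges as soon as each coordinate does.
\<close>

lemma mcomplete_weighted_dist:
  assumes complete: "\<And>i. i \<in> I \<Longrightarrow> mcomplete_of (M i)"
  shows "Metric_space.mcomplete (\<Pi>\<^sub>E i\<in>I. mspace (M i)) (weighted_dist I M w)"
proof -
  interpret W: Metric_space "\<Pi>\<^sub>E i\<in>I. mspace (M i)" "weighted_dist I M w"
    by (rule Metric_space_weighted_dist)
  show ?thesis
    unfolding W.mcomplete_def
  proof (intro allI impI)
    fix \<sigma> assume \<sigma>: "W.MCauchy \<sigma>"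
    have \<sigma>_in: "\<sigma> k \<in> (\<Pi>\<^sub>E i\<in>I. mspace (M i))" for k
      using \<sigma> unfolding W.MCauchy_def by blast
    have "\<exists>a. limitin (mtopology_of (M i)) (\<lambda>k. \<sigma> k i) a sequentially" if i: "i \<in> I" for i
    proof -
      interpret Mi: Metric_space "mspace (M i)" "mdist (M i)"
        by (rule Metric_space_mspace_mdist)
      have "Mi.MCauchy (\<lambda>k. \<sigma> k i)"
        unfolding Mi.MCauchy_def
      proof (intro conjI allI impI)
        show "range (\<lambda>k. \<sigma> k i) \<subseteq> mspace (M i)"
          using \<sigma>_in i by (auto simp: PiE_iff)
        fix \<epsilon> :: real assume "\<epsilon> > 0"
        then have "\<epsilon> / w i > 0" using w_pos[OF i] by simp
        then obtain N where
          N: "\<And>k l. N \<le> k \<Longrightarrow> N \<le> l \<Longrightarrow> weighted_dist I M w (\<sigma> k) (\<sigma> l) < \<epsilon> / w i"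
          using \<sigma> unfolding W.MCauchy_def by metis
        have "mdist (M i) (\<sigma> k i) (\<sigma> l i) < \<epsilon>" if "N \<le> k" "N \<le> l" for k l
          using N[OF that] i w_pos[OF i] unfolding weighted_dist_less_iff by force
        then show "\<exists>N. \<forall>k l. N \<le> k \<longrightarrow> N \<le> l \<longrightarrow> mdist (M i) (\<sigma> k i) (\<sigma> l i) < \<epsilon>"
          by blast
      qed
      then show ?thesis
        using complete[OF i]
        unfolding mcomplete_of_def Mi.mcomplete_def mtopology_of_def by blast
    qed
    then obtain a where
      a: "\<And>i. i \<in> I \<Longrightarrow> limitin (mtopology_of (M i)) (\<lambda>k. \<sigma> k i) (a i) sequentially"
      by metis
    have a_in: "a i \<in> mspace (M i)" if "i \<in> I" for i
      using limitin_topspace[OF a[OF that]] by simp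
    have a_lim: "(\<lambda>k. mdist (M i) (\<sigma> k i) (a i)) \<longlonglongrightarrow> 0" if i: "i \<in> I" for i
    proof -
      interpret Mi: Metric_space "mspace (M i)" "mdist (M i)"
        by (rule Metric_space_mspace_mdist)
      have "limitin Mi.mtopology (\<lambda>k. \<sigma> k i) (a i) sequentially"
        using a[OF i] unfolding mtopology_of_def .
      then show ?thesis unfolding Mi.limitin_metric_dist_null by (elim conjE)
    qed
    have "limitin W.mtopology \<sigma> (restrict a I) sequentially"
      unfolding W.limitin_metric
    proof (intro conjI allI impI)
      show "restrict a I \<in> (\<Pi>\<^sub>E i\<in>I. mspace (M i))" using a_in by auto
      fix \<epsilon> :: real assume "\<epsilon> > 0"
      have "\<forall>\<^sub>F k in sequentially. mdist (M i) (\<sigma> k i) (a i) < \<epsilon> * w i" if "i \<in> I" for i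
        using order_tendstoD(2)[OF a_lim[OF that]] \<open>\<epsilon> > 0\<close> w_pos[OF that] by simp
      then have "\<forall>\<^sub>F k in sequentially. \<forall>i\<in>I. mdist (M i) (\<sigma> k i) (a i) < \<epsilon> * w i"
        using finite_I by (simp add: eventually_ball_finite)
      then show "\<forall>\<^sub>F k in sequentially. \<sigma> k \<in> (\<Pi>\<^sub>E i\<in>I. mspace (M i))
          \<and> weighted_dist I M w (\<sigma> k) (restrict a I) < \<epsilon>"
        by (rule eventually_mono) (intro conjI \<sigma>_in, simp add: weighted_dist_less_iff)
    qed
    then show "\<exists>x. limitin W.mtopology \<sigma> x sequentially" by blast
  qed
qed

text \<open>
  The Banach fixed point theorem in the weighted metric. The contraction hypothesis is phrased
  with coordinatewise bounds \<open>q * w i\<close>, the form in which a matrix inequality \<open>A w \<le> c w\<close>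
  delivers it.
\<close>

lemma weighted_contraction_attracting_fixed_point:
  assumes complete: "\<And>i. i \<in> I \<Longrightarrow> mcomplete_of (M i)"
    and nonempty: "\<And>i. i \<in> I \<Longrightarrow> mspace (M i) \<noteq> {}"
    and F: "F \<in> (\<Pi>\<^sub>E i\<in>I. mspace (M i)) \<rightarrow> (\<Pi>\<^sub>E i\<in>I. mspace (M i))"
    and c: "0 \<le> c" "c < 1"
    and contr: "\<And>x y q i. x \<in> (\<Pi>\<^sub>E i\<in>I. mspace (M i)) \<Longrightarrow> y \<in> (\<Pi>\<^sub>E i\<in>I. mspace (M i)) \<Longrightarrow>
       0 \<le> q \<Longrightarrow> (\<And>i. i \<in> I \<Longrightarrow> mdist (M i) (x i) (y i) \<le> q * w i) \<Longrightarrow> i \<in> I \<Longrightarrow>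
       mdist (M i) (F x i) (F y i) \<le> c * q * w i"
  shows "\<exists>p\<in>(\<Pi>\<^sub>E i\<in>I. mspace (M i)). F p = p \<and>
    (\<forall>x\<in>(\<Pi>\<^sub>E i\<in>I. mspace (M i)). \<forall>i\<in>I. (\<lambda>k. mdist (M i) ((F ^^ k) x i) (p i)) \<longlonglongrightarrow> 0)"
proof -
  let ?P = "\<Pi>\<^sub>E i\<in>I. mspace (M i)" and ?d = "weighted_dist I M w"
  interpret W: Metric_space ?P ?d
    by (rule Metric_space_weighted_dist)
  have lip: "?d (F x) (F y) \<le> c * ?d x y" if "x \<in> ?P" "y \<in> ?P" for x y
    unfolding weighted_dist_le_iff
    using contr[OF that weighted_dist_nonneg[of x y] mdist_le_weighted_dist] by blast
  have "?P \<noteq> {}" using nonempty by (simp add: PiE_eq_empty_iff)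
  from W.Banach_fixedpoint_thm[OF mcomplete_weighted_dist[OF complete] this F c(2) lip]
  obtain p where p: "p \<in> ?P" "F p = p" by blast
  show ?thesis
  proof (intro bexI[of _ p] conjI ballI p)
    fix x i assume x: "x \<in> ?P" and i: "i \<in> I"
    have iter_in: "(F ^^ k) x \<in> ?P" for k
      by (induction k) (use x F in auto)
    have iter: "?d ((F ^^ k) x) p \<le> c ^ k * ?d x p" for k
    proof (induction k)
      case (Suc k)
      have "?d ((F ^^ Suc k) x) p \<le> c * ?d ((F ^^ k) x) p"
        using lip[OF iter_in[of k] p(1)] p(2) by simp
      also have "\<dots> \<le> c * (c ^ k * ?d x p)"
        using Suc c(1) by (intro mult_left_mono)
      finally show ?case by (simp add: mult_ac)
    qed simp
    have bound: "mdist (M i) ((F ^^ k) x i) (p i) \<le> c ^ k * (?d x p * w i)" for k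
    proof -
      have "mdist (M i) ((F ^^ k) x i) (p i) \<le> ?d ((F ^^ k) x) p * w i"
        by (rule mdist_le_weighted_dist[OF i])
      also have "\<dots> \<le> c ^ k * ?d x p * w i"
        using iter[of k] w_pos[OF i] by (intro mult_right_mono) auto
      finally show ?thesis by (simp add: mult_ac)
    qed
    have bound_lim: "(\<lambda>k. c ^ k * (?d x p * w i)) \<longlonglongrightarrow> 0"
      using c by (intro tendsto_mult_left_zero LIMSEQ_power_zero) auto
    show "(\<lambda>k. mdist (M i) ((F ^^ k) x i) (p i)) \<longlonglongrightarrow> 0"
      by (rule tendsto_sandwich[OF _ _ tendsto_const bound_lim])
        (intro always_eventually allI mdist_nonneg bound)+
  qed
qed

end


section \<open>The undelayed map inside the associated network\<close>

fun node_site :: "node \<Rightarrow> nat"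
  where
    "node_site (Node i) = i"
  | "node_site (Delay i j l m) = i"

text \<open>
  The embedding of \<open>X\<close> into the state space of the associated network as the states with a
  constant past.
\<close>

definition constant_lift ::
    "nat \<Rightarrow> (nat \<Rightarrow> (nat \<times> int) set) \<Rightarrow> (nat \<Rightarrow> 'a) \<Rightarrow> node \<Rightarrow> 'a"
  where "constant_lift n D x = (\<lambda>\<alpha>\<in>nodes n D. x (node_site \<alpha>))"

lemma node_space_site: "node_space X \<alpha> = X (node_site \<alpha>)"
  by (cases \<alpha>) auto

lemma node_site_delay_node [simp]: "node_site (delay_node i j l m) = i"
  by (simp add: delay_node_def)

context
  fixes n T :: nat and D :: "nat \<Rightarrow> (nat \<times> int) set"
  assumes D: "\<And>j. j \<in> {1..n} \<Longrightarrow> D j \<subseteq> {1..n} \<times> delay_times T"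
begin

lemma node_site_in:
  assumes "\<alpha> \<in> nodes n D"
  shows "node_site \<alpha> \<in> {1..n}"
  using assms D unfolding nodes_def delay_nodes_def by fastforce

lemma finite_nodes: "finite (nodes n D)"
proof -
  have "delay_nodes n D \<subseteq> (\<lambda>(i, j, l, m). Delay i j l m) ` ({1..n} \<times> {1..n} \<times> {..T} \<times> {..T})"
  proof
    fix \<alpha> assume "\<alpha> \<in> delay_nodes n D"
    then obtain i j l m where \<alpha>: "\<alpha> = Delay i j l m" and j: "j \<in> {1..n}"
      and ij: "(i, - int m) \<in> D j" and l: "1 \<le> l" "l \<le> m"
      unfolding delay_nodes_def by blast
    have "i \<in> {1..n}" "- int m \<in> delay_times T" using D[OF j] ij by auto
    then have "(i, j, l, m) \<in> {1..n} \<times> {1..n} \<times> {..T} \<times> {..T}"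
      using j l unfolding delay_times_def by auto
    then show "\<alpha> \<in> (\<lambda>(i, j, l, m). Delay i j l m) ` ({1..n} \<times> {1..n} \<times> {..T} \<times> {..T})"
      unfolding \<alpha> by force
  qed
  then have "finite (delay_nodes n D)" by (rule finite_subset) auto
  then show ?thesis unfolding nodes_def by simp
qed

lemma delay_node_in_nodes:
  assumes "j \<in> {1..n}" "(i, - int m) \<in> D j" "l \<le> m"
  shows "delay_node i j l m \<in> nodes n D"
  using assms D[OF assms(1)] unfolding delay_node_def nodes_def delay_nodes_def by auto

lemma constant_lift_in_assoc_space:
  assumes x: "x \<in> state_space n X"
  shows "constant_lift n D x \<in> assoc_space n X D"
  using x node_site_in
  by (auto simp: assoc_space_def constant_lift_def state_space_def node_space_site nodes_def)

lemma assoc_map_constant_lift_Node: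
  assumes j: "j \<in> {1..n}"
  shows "assoc_map n \<phi> D h (constant_lift n D x) (Node j) = h j (\<lambda>(i, \<tau>)\<in>D j. \<phi> i (x i))"
proof -
  have "constant_lift n D x (delay_node i j (nat (- \<tau>)) (nat (- \<tau>))) = x i"
    if i\<tau>: "(i, \<tau>) \<in> D j" for i \<tau>
  proof -
    \<comment> \<open>Delay times are nonpositive, so no information is lost in passing to \<open>nat (- \<tau>)\<close>.\<close>
    have "\<tau> = - int (nat (- \<tau>))" using D[OF j] i\<tau> unfolding delay_times_def by auto
    then have "delay_node i j (nat (- \<tau>)) (nat (- \<tau>)) \<in> nodes n D"
      using j i\<tau> by (intro delay_node_in_nodes) auto
    then show ?thesis by (simp add: constant_lift_def)
  qed
  then have "(\<lambda>(i, \<tau>)\<in>D j. \<phi> i (constant_lift n D x (delay_node i j (nat (- \<tau>)) (nat (- \<tau>)))))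
      = (\<lambda>(i, \<tau>)\<in>D j. \<phi> i (x i))"
    by (intro restrict_ext) auto
  moreover have "Node j \<in> nodes n D" using j unfolding nodes_def by simp
  ultimately show ?thesis by (simp add: assoc_map_def)
qed

lemma assoc_map_constant_lift_Delay:
  assumes "j \<in> {1..n}" "(i, - int m) \<in> D j" "1 \<le> l" "l \<le> m"
  shows "assoc_map n \<phi> D h (constant_lift n D x) (Delay i j l m) = x i"
proof -
  have "Delay i j l m \<in> nodes n D"
    using assms unfolding nodes_def delay_nodes_def by blast
  moreover have "delay_node i j (l - 1) m \<in> nodes n D"
    using assms by (intro delay_node_in_nodes) auto
  ultimately show ?thesis by (simp add: assoc_map_def constant_lift_def)
qed

context
  fixes X :: "nat \<Rightarrow> 'a metric" and \<phi> :: "nat \<Rightarrow> 'a \<Rightarrow> 'a"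
    and h :: "nat \<Rightarrow> (nat \<times> int \<Rightarrow> 'a) \<Rightarrow> 'a" and \<Lambda> :: "node \<Rightarrow> node \<Rightarrow> real"
  assumes \<Lambda>: "stability_coefficients n X \<phi> D h \<Lambda>"
begin

lemma stability_estimate_constant_lift:
  assumes x: "x \<in> state_space n X" and y: "y \<in> state_space n X" and \<beta>: "\<beta> \<in> nodes n D"
  shows "mdist (X (node_site \<beta>)) (assoc_map n \<phi> D h (constant_lift n D x) \<beta>)
      (assoc_map n \<phi> D h (constant_lift n D y) \<beta>)
    \<le> (\<Sum>\<alpha>\<in>nodes n D. \<Lambda> \<alpha> \<beta> * mdist (X (node_site \<alpha>)) (x (node_site \<alpha>)) (y (node_site \<alpha>)))"
proof -
  have "mdist (node_space X \<beta>) (assoc_map n \<phi> D h (constant_lift n D x) \<beta>)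
      (assoc_map n \<phi> D h (constant_lift n D y) \<beta>)
    \<le> (\<Sum>\<alpha>\<in>nodes n D. \<Lambda> \<alpha> \<beta> *
        mdist (node_space X \<alpha>) (constant_lift n D x \<alpha>) (constant_lift n D y \<alpha>))"
    using \<Lambda> \<beta> constant_lift_in_assoc_space[OF x] constant_lift_in_assoc_space[OF y]
    unfolding stability_coefficients_def by blast
  also have "\<dots> = (\<Sum>\<alpha>\<in>nodes n D. \<Lambda> \<alpha> \<beta> *
        mdist (X (node_site \<alpha>)) (x (node_site \<alpha>)) (y (node_site \<alpha>)))"
    by (intro sum.cong) (auto simp: node_space_site constant_lift_def)
  finally show ?thesis by (simp add: node_space_site)
qed

text \<open>
  The component of a delay node is the projection to its predecessor, which is its only variable,
  and a projection to a space with two distinct points has no Lipschitz constant below one.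
\<close>

lemma delay_coefficient_ge_one:
  assumes x: "x \<in> state_space n X" and y: "y \<in> state_space n X" and neq: "x i \<noteq> y i"
    and j: "j \<in> {1..n}" and im: "(i, - int m) \<in> D j" and l: "1 \<le> l" "l \<le> m"
  shows "\<Lambda> (delay_node i j (l - 1) m) (Delay i j l m) \<ge> 1"
proof -
  let ?\<beta> = "Delay i j l m" and ?\<gamma> = "delay_node i j (l - 1) m"
  let ?t = "\<lambda>\<alpha>. \<Lambda> \<alpha> ?\<beta> * mdist (X (node_site \<alpha>)) (x (node_site \<alpha>)) (y (node_site \<alpha>))"
  have \<beta>: "?\<beta> \<in> nodes n D" using j im l unfolding nodes_def delay_nodes_def by blast
  have \<gamma>: "?\<gamma> \<in> nodes n D" using j im l by (intro delay_node_in_nodes) auto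
  have i: "i \<in> {1..n}" using node_site_in[OF \<beta>] by simp
  have "mdist (X i) (x i) (y i) \<le> (\<Sum>\<alpha>\<in>nodes n D. ?t \<alpha>)"
    using stability_estimate_constant_lift[OF x y \<beta>]
    by (simp add: assoc_map_constant_lift_Delay[OF j im l])
  also have "(\<Sum>\<alpha>\<in>nodes n D. ?t \<alpha>) = (\<Sum>\<alpha>\<in>{?\<gamma>}. ?t \<alpha>)"
    using \<gamma> \<beta> \<Lambda> finite_nodes
    by (intro sum.mono_neutral_right) (auto simp: stability_coefficients_def)
  also have "\<dots> = \<Lambda> ?\<gamma> ?\<beta> * mdist (X i) (x i) (y i)" by simp
  finally have "mdist (X i) (x i) (y i) \<le> \<Lambda> ?\<gamma> ?\<beta> * mdist (X i) (x i) (y i)" .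
  moreover have "mdist (X i) (x i) (y i) > 0"
  proof -
    have "x i \<in> mspace (X i)" "y i \<in> mspace (X i)"
      using x y i unfolding state_space_def by auto
    then show ?thesis
      using neq mdist_zero[of "x i" "X i" "y i"] mdist_nonneg[of "X i" "x i" "y i"] by linarith
  qed
  ultimately show ?thesis by simp
qed

context
  fixes w :: "node \<Rightarrow> real" and c :: real
  assumes w_pos: "\<And>\<alpha>. \<alpha> \<in> nodes n D \<Longrightarrow> w \<alpha> > 0"
    and c: "c \<le> 1"
    and w_contr: "\<And>\<beta>. \<beta> \<in> nodes n D \<Longrightarrow> (\<Sum>\<alpha>\<in>nodes n D. \<Lambda> \<alpha> \<beta> * w \<alpha>) \<le> c * w \<beta>"
begin

text \<open>
  Induction along the chain \<open>i = (i, j; 0, m), (i, j; 1, m), \<dots>, (i, j; m, m)\<close>: in the inequality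
  \<open>\<Sum>\<^sub>\<alpha> \<Lambda>\<^sub>\<alpha>\<^sub>\<beta> w\<^sub>\<alpha> \<le> c w\<^sub>\<beta>\<close> at a node \<open>\<beta>\<close> of the chain, the term of its predecessor alone is at
  least the weight of the predecessor.
\<close>

lemma weight_le_delay_weight:
  assumes x: "x \<in> state_space n X" and y: "y \<in> state_space n X" and neq: "x i \<noteq> y i"
    and j: "j \<in> {1..n}" and im: "(i, - int m) \<in> D j"
  shows "l \<le> m \<Longrightarrow> w (Node i) \<le> w (delay_node i j l m)"
proof (induction l)
  case 0
  show ?case by (simp add: delay_node_def)
next
  case (Suc l)
  let ?\<beta> = "Delay i j (Suc l) m" and ?\<gamma> = "delay_node i j l m"
  have \<beta>: "?\<beta> \<in> nodes n D" using j im Suc.prems unfolding nodes_def delay_nodes_def by auto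
  have \<gamma>: "?\<gamma> \<in> nodes n D" using j im Suc.prems by (intro delay_node_in_nodes) auto
  have "w ?\<gamma> \<le> \<Lambda> ?\<gamma> ?\<beta> * w ?\<gamma>"
    using delay_coefficient_ge_one[OF x y neq j im, of "Suc l"] Suc.prems w_pos[OF \<gamma>] by simp
  also have "\<dots> \<le> (\<Sum>\<alpha>\<in>nodes n D. \<Lambda> \<alpha> ?\<beta> * w \<alpha>)"
    using \<gamma> \<beta> \<Lambda> finite_nodes
    by (intro member_le_sum)
      (auto simp: stability_coefficients_def intro!: mult_nonneg_nonneg less_imp_le[OF w_pos])
  also have "\<dots> \<le> c * w ?\<beta>" by (rule w_contr[OF \<beta>])
  also have "\<dots> \<le> w ?\<beta>" using c w_pos[OF \<beta>] by simp
  finally show ?case using Suc by (simp add: delay_node_def)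
qed

text \<open>
  At a site where \<open>x\<close> and \<open>y\<close> differ, the delay nodes weigh at least as much as the site itself.
  The bounds \<open>q w\<^sub>i\<close> at the sites hence extend to bounds \<open>q w\<^sub>\<alpha>\<close> at all nodes, and the stability
  inequality can be applied.
\<close>

lemma assoc_map_constant_lift_contraction:
  assumes x: "x \<in> state_space n X" and y: "y \<in> state_space n X" and q: "0 \<le> q"
    and bound: "\<And>i. i \<in> {1..n} \<Longrightarrow> mdist (X i) (x i) (y i) \<le> q * w (Node i)"
    and j: "j \<in> {1..n}"
  shows "mdist (X j) (assoc_map n \<phi> D h (constant_lift n D x) (Node j))
      (assoc_map n \<phi> D h (constant_lift n D y) (Node j)) \<le> c * q * w (Node j)"
proof -
  have Node_j: "Node j \<in> nodes n D" using j unfolding nodes_def by simp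
  have node_bound:
    "mdist (X (node_site \<alpha>)) (x (node_site \<alpha>)) (y (node_site \<alpha>)) \<le> q * w \<alpha>"
    if \<alpha>: "\<alpha> \<in> nodes n D" for \<alpha>
  proof (cases "x (node_site \<alpha>) = y (node_site \<alpha>)")
    case True
    have "x (node_site \<alpha>) \<in> mspace (X (node_site \<alpha>))"
      using x node_site_in[OF \<alpha>] unfolding state_space_def by auto
    then have "mdist (X (node_site \<alpha>)) (x (node_site \<alpha>)) (y (node_site \<alpha>)) = 0"
      using True mdist_zero by metis
    then show ?thesis using q w_pos[OF \<alpha>] by simp
  next
    case False
    have "w (Node (node_site \<alpha>)) \<le> w \<alpha>"
    proof (cases \<alpha>)
      case (Delay i j l m)
      then have "j \<in> {1..n}" "(i, - int m) \<in> D j" "1 \<le> l" "l \<le> m"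
        using \<alpha> unfolding nodes_def delay_nodes_def by auto
      then show ?thesis
        using weight_le_delay_weight[OF x y, of i j m l] False Delay
        by (simp add: delay_node_def)
    qed simp
    then have "q * w (Node (node_site \<alpha>)) \<le> q * w \<alpha>" using q by (rule mult_left_mono)
    then show ?thesis using bound[OF node_site_in[OF \<alpha>]] by linarith
  qed
  have "mdist (X j) (assoc_map n \<phi> D h (constant_lift n D x) (Node j))
      (assoc_map n \<phi> D h (constant_lift n D y) (Node j))
    \<le> (\<Sum>\<alpha>\<in>nodes n D. \<Lambda> \<alpha> (Node j) *
        mdist (X (node_site \<alpha>)) (x (node_site \<alpha>)) (y (node_site \<alpha>)))"
    using stability_estimate_constant_lift[OF x y Node_j] by simp
  also have "\<dots> \<le> (\<Sum>\<alpha>\<in>nodes n D. \<Lambda> \<alpha> (Node j) * (q * w \<alpha>))"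
    using \<Lambda> Node_j
    by (intro sum_mono mult_left_mono node_bound) (auto simp: stability_coefficients_def)
  also have "\<dots> = q * (\<Sum>\<alpha>\<in>nodes n D. \<Lambda> \<alpha> (Node j) * w \<alpha>)"
    by (simp add: sum_distrib_left mult_ac)
  also have "\<dots> \<le> q * (c * w (Node j))"
    by (intro mult_left_mono w_contr[OF Node_j] q)
  finally show ?thesis by (simp add: mult_ac)
qed

end

end

end

text \<open>
  The transpose in the definition of a stability matrix makes \<open>A w \<le> c w\<close> a statement about the
  columns of \<open>\<Lambda>\<close>, that is, about the stability inequalities of the single components.
\<close>

lemma stability_matrix_weights:
  assumes A: "stability_matrix n X \<phi> D h A"
    and fin: "finite (nodes n D)" and nonempty: "nodes n D \<noteq> {}"
    and sr: "spectral_radius (map_mat complex_of_real A) < 1"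
  shows "\<exists>\<Lambda> w c. stability_coefficients n X \<phi> D h \<Lambda> \<and> 0 \<le> c \<and> c < 1 \<and>
    (\<forall>\<alpha>\<in>nodes n D. w \<alpha> > (0::real)) \<and>
    (\<forall>\<beta>\<in>nodes n D. (\<Sum>\<alpha>\<in>nodes n D. \<Lambda> \<alpha> \<beta> * w \<alpha>) \<le> c * w \<beta>)"
proof -
  let ?m = "card (nodes n D)"
  obtain \<Lambda> e where \<Lambda>: "stability_coefficients n X \<phi> D h \<Lambda>"
    and e: "bij_betw e {..<?m} (nodes n D)"
    and A_eq: "A = transpose_mat (mat ?m ?m (\<lambda>(a, b). \<Lambda> (e a) (e b)))"
    using A unfolding stability_matrix_def by blast
  have A_carrier: "A \<in> carrier_mat ?m ?m" unfolding A_eq by simp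
  have A_entry: "A $$ (a, b) = \<Lambda> (e b) (e a)" if "a < ?m" "b < ?m" for a b
    using that unfolding A_eq by simp
  have e_in: "e a \<in> nodes n D" if "a < ?m" for a
    using bij_betwE[OF e] that by auto
  have "?m > 0" using fin nonempty by (simp add: card_gt_0_iff)
  moreover have "A $$ (a, b) \<ge> 0" if "a < ?m" "b < ?m" for a b
    using \<Lambda> e_in that unfolding stability_coefficients_def by (simp add: A_entry)
  ultimately obtain v c where c: "0 \<le> c" "c < 1"
    and v: "\<And>a. a < ?m \<Longrightarrow> v a > (0::real)"
      "\<And>a. a < ?m \<Longrightarrow> (\<Sum>b<?m. A $$ (a, b) * v b) \<le> c * v a"
    using positive_weights_contracted_by_matrix[OF A_carrier _ _ sr] by metis
  define w where "w = v \<circ> inv_into {..<?m} e"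
  have w_e: "w (e a) = v a" if "a < ?m" for a
    using that e by (simp add: w_def bij_betw_inv_into_left)
  have node_cases: "\<exists>a<?m. \<alpha> = e a" if "\<alpha> \<in> nodes n D" for \<alpha>
    using that e unfolding bij_betw_def by blast
  show ?thesis
  proof (intro exI conjI ballI)
    show "stability_coefficients n X \<phi> D h \<Lambda>" "0 \<le> c" "c < 1" by (fact \<Lambda> c)+
    show "w \<alpha> > 0" if "\<alpha> \<in> nodes n D" for \<alpha>
      using node_cases[OF that] w_e v(1) by auto
    fix \<beta> assume "\<beta> \<in> nodes n D"
    then obtain b where b: "b < ?m" "\<beta> = e b" using node_cases by blast
    have "(\<Sum>\<alpha>\<in>nodes n D. \<Lambda> \<alpha> \<beta> * w \<alpha>) = (\<Sum>a<?m. \<Lambda> (e a) \<beta> * w (e a))"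
      by (rule sum.reindex_bij_betw[OF e, symmetric])
    also have "\<dots> = (\<Sum>a<?m. A $$ (b, a) * v a)"
      by (intro sum.cong) (auto simp: b w_e A_entry)
    also have "\<dots> \<le> c * w \<beta>" using v(2)[OF b(1)] b w_e by simp
    finally show "(\<Sum>\<alpha>\<in>nodes n D. \<Lambda> \<alpha> \<beta> * w \<alpha>) \<le> c * w \<beta>" .
  qed
qed

lemma undelayed_map_state_space_components:
  assumes H: "time_delayed_interaction n X T D h H"
    and \<phi>: "\<And>i. i \<in> {1..n} \<Longrightarrow> \<phi> i \<in> mspace (X i) \<rightarrow> mspace (X i)"
    and x: "x \<in> state_space n X"
  shows "undelayed_map n T \<phi> H x \<in> state_space n X"
    and "\<And>j. j \<in> {1..n} \<Longrightarrow> undelayed_map n T \<phi> H x j = h j (\<lambda>(i, \<tau>)\<in>D j. \<phi> i (x i))"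
proof -
  let ?z = "\<lambda>\<tau>\<in>delay_times T. \<lambda>i\<in>{1..n}. \<phi> i ((\<lambda>\<tau>\<in>delay_times T. x) \<tau> i)"
  have z: "?z \<in> history_space n X T"
    using x \<phi> unfolding history_space_def state_space_def by (auto simp: PiE_iff Pi_iff)
  have eq: "undelayed_map n T \<phi> H x = H ?z"
    unfolding undelayed_map_def delayed_map_def ..
  show "undelayed_map n T \<phi> H x \<in> state_space n X"
    using H z unfolding eq time_delayed_interaction_def by blast
  fix j assume j: "j \<in> {1..n}"
  have Dj: "D j \<subseteq> {1..n} \<times> delay_times T"
    and Hj: "H ?z j = h j (\<lambda>(i, \<tau>)\<in>D j. ?z \<tau> i)"
    using H z j unfolding time_delayed_interaction_def by blast+
  have "(\<lambda>(i, \<tau>)\<in>D j. ?z \<tau> i) = (\<lambda>(i, \<tau>)\<in>D j. \<phi> i (x i))"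
    using Dj by (intro restrict_ext) auto
  then show "undelayed_map n T \<phi> H x j = h j (\<lambda>(i, \<tau>)\<in>D j. \<phi> i (x i))"
    unfolding eq Hj by simp
qed

theorem theorem4p2:
  fixes n T :: nat
    and X :: "nat \<Rightarrow> 'a metric"
    and \<phi> :: "nat \<Rightarrow> 'a \<Rightarrow> 'a"
    and D :: "nat \<Rightarrow> (nat \<times> int) set"
    and h :: "nat \<Rightarrow> (nat \<times> int \<Rightarrow> 'a) \<Rightarrow> 'a"
    and H :: "(int \<Rightarrow> nat \<Rightarrow> 'a) \<Rightarrow> nat \<Rightarrow> 'a"
    and A :: "real mat"
  assumes "n \<ge> 1" and "T \<ge> 1"
    and "\<And>i. i \<in> {1..n} \<Longrightarrow> mspace (X i) \<noteq> {}"
    and "\<And>i. i \<in> {1..n} \<Longrightarrow> mcomplete_of (X i)"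
    and "\<And>i. i \<in> {1..n} \<Longrightarrow> \<phi> i \<in> mspace (X i) \<rightarrow> mspace (X i)"
    and "\<And>i. i \<in> {1..n} \<Longrightarrow> lipschitz_constant (X i) (\<phi> i) < \<infinity>"
    and "time_delayed_interaction n X T D h H"
    and "stability_matrix n X \<phi> D h A"
    and "spectral_radius (map_mat complex_of_real A) < 1"
  shows "\<exists>p. globally_attracting_fixed_point n X (undelayed_map n T \<phi> H) p"
proof -
  have D: "D j \<subseteq> {1..n} \<times> delay_times T" if "j \<in> {1..n}" for j
    using assms(7) that unfolding time_delayed_interaction_def by blast
  have nonempty: "nodes n D \<noteq> {}" using \<open>n \<ge> 1\<close> unfolding nodes_def by auto
  have fin: "finite (nodes n D)" by (rule finite_nodes) (rule D)
  obtain \<Lambda> w c where \<Lambda>: "stability_coefficients n X \<phi> D h \<Lambda>" and c: "0 \<le> c" "c < 1"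
    and w_pos: "\<forall>\<alpha>\<in>nodes n D. w \<alpha> > (0::real)"
    and w_contr: "\<forall>\<beta>\<in>nodes n D. (\<Sum>\<alpha>\<in>nodes n D. \<Lambda> \<alpha> \<beta> * w \<alpha>) \<le> c * w \<beta>"
    using stability_matrix_weights[OF assms(8) fin nonempty assms(9)] by (elim exE conjE) (rule that)
  let ?U = "undelayed_map n T \<phi> H"
  have U_in: "?U x \<in> state_space n X" if "x \<in> state_space n X" for x
    by (rule undelayed_map_state_space_components(1)[OF assms(7) _ that]) (rule assms(5))
  have U_lift: "?U x j = assoc_map n \<phi> D h (constant_lift n D x) (Node j)"
    if "x \<in> state_space n X" "j \<in> {1..n}" for x j
  proof -
    have "?U x j = h j (\<lambda>(i, \<tau>)\<in>D j. \<phi> i (x i))"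
      by (rule undelayed_map_state_space_components(2)[OF assms(7) _ that]) (rule assms(5))
    also have "\<dots> = assoc_map n \<phi> D h (constant_lift n D x) (Node j)"
      by (rule assoc_map_constant_lift_Node[OF _ that(2), symmetric]) (rule D)
    finally show ?thesis .
  qed
  have pos: "w (Node i) > 0" if "i \<in> {1..n}" for i
    using that w_pos by (simp add: nodes_def)
  have contr: "mdist (X j) (?U x j) (?U y j) \<le> c * q * w (Node j)"
    if "x \<in> state_space n X" "y \<in> state_space n X" "0 \<le> q"
      "\<And>i. i \<in> {1..n} \<Longrightarrow> mdist (X i) (x i) (y i) \<le> q * w (Node i)" "j \<in> {1..n}" for x y q j
    unfolding U_lift[OF that(1,5)] U_lift[OF that(2,5)]
    by (rule assoc_map_constant_lift_contraction[OF _ \<Lambda> _ less_imp_le[OF c(2)] _ that(1-3)])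
      (use D w_pos w_contr that(4,5) in blast)+
  have "\<exists>p\<in>state_space n X. ?U p = p \<and>
    (\<forall>x\<in>state_space n X. \<forall>i\<in>{1..n}. (\<lambda>k. mdist (X i) ((?U ^^ k) x i) (p i)) \<longlonglongrightarrow> 0)"
  proof (rule weighted_contraction_attracting_fixed_point
      [of "{1..n}" "\<lambda>i. w (Node i)" X ?U c, folded state_space_def])
    show "?U \<in> state_space n X \<rightarrow> state_space n X" using U_in by blast
    show "{1..n} \<noteq> {}" using \<open>n \<ge> 1\<close> by simp
  qed (fact finite_atLeastAtMost pos assms(3) assms(4) c contr)+
  then obtain p where p: "p \<in> state_space n X" "?U p = p"
    and lim: "\<And>x i. x \<in> state_space n X \<Longrightarrow> i \<in> {1..n} \<Longrightarrow>
      (\<lambda>k. mdist (X i) ((?U ^^ k) x i) (p i)) \<longlonglongrightarrow> 0"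
    by blast
  have "(\<lambda>k. d_max n X ((?U ^^ k) x) p) \<longlonglongrightarrow> 0" if x: "x \<in> state_space n X" for x
  proof -
    have lower: "0 \<le> d_max n X ((?U ^^ k) x) p" for k
      using \<open>n \<ge> 1\<close> by (auto simp: d_max_def Max_ge_iff)
    have upper: "d_max n X ((?U ^^ k) x) p \<le> (\<Sum>i=1..n. mdist (X i) ((?U ^^ k) x i) (p i))" for k
      using \<open>n \<ge> 1\<close> by (auto simp: d_max_def intro!: member_le_sum)
    have upper_lim: "(\<lambda>k. \<Sum>i=1..n. mdist (X i) ((?U ^^ k) x i) (p i)) \<longlonglongrightarrow> 0"
      using lim[OF x] by (intro tendsto_null_sum) auto
    show ?thesis
      by (rule tendsto_sandwich[OF _ _ tendsto_const upper_lim])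
        (intro always_eventually allI lower upper)+
  qed
  then show ?thesis using p unfolding globally_attracting_fixed_point_def by blast
qed

end
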